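(* Let $X$ be a real Banach space with continuous dual $X^*$, let $A\colon X\rightrightarrows X^*$ be maximally monotone, and suppose that $\operatorname{gra}A$ is weak$\times$weak$^*$ closed in $X\times X^*$. Let $(a,a^* )\in\operatorname{gra}A$ and define $\widetilde A\colon X\rightrightarrows X^*$ by $\operatorname{gra}\widetilde A:=\operatorname{gra}A-\{(a,a^* )\}$. Then $A$ is non-enlargeable if and only if $\operatorname{gra}A$ is convex and $$\operatorname{gra}(-\widetilde A^* )\cap (X\times X^* )\subseteq\operatorname{gra}\widetilde A.$$ In particular, when this is the case, $\langle x,x^*\rangle=0$ for all $(x,x^* )\in\operatorname{gra}\widetilde A^*\cap (X\times X^* )$.
   Context: $X$ is identified with its canonical image in $X^{**}$, and $\langle\cdot,\cdot\rangle$ denotes duality pairings. A set-valued operator $A\colon X\rightrightarrows X^*$ assigns to each $x\in X$ a subset $Ax\subseteq X^*$; $\operatorname{gra}A:=\{(x,x^* )\in X\times X^*\mid x^*\in Ax\}$. $A$ is monotone if $\langle x-y,x^*-y^*\rangle\ge 0$ for all $(x,x^* ),(y,y^* )\in\operatorname{gra}A$, and maximally monotone if it is monotone and no monotone operator has a graph strictly containing $\operatorname{gra}A$. Weak$\times$weak$^*$ closed means closed in the product of the weak topology of $X$ and the weak$^*$ topology of $X^*$. For $\varepsilon\ge0$, the enlargement $A_\varepsilon\colon X\rightrightarrows X^*$ is given by $\operatorname{gra}A_\varepsilon:=\{(x,x^* )\in X\times X^*\mid \langle x^*-y^*,x-y\rangle\ge-\varepsilon,\ \forall (y,y^* )\in\operatorname{gra}A\}$.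 A monotone operator $A$ is non-enlargeable if $\operatorname{gra}A=\operatorname{gra}A_\varepsilon$ for every $\varepsilon\ge0$. The adjoint $B^*\colon X^{**}\rightrightarrows X^*$ of an operator $B\colon X\rightrightarrows X^*$ is defined by $\operatorname{gra}B^*:=\{(x^{**},x^* )\in X^{**}\times X^*\mid \langle b,x^*\rangle=\langle b^*,x^{**}\rangle,\ \forall (b,b^* )\in\operatorname{gra}B\}$, and $\operatorname{gra}(-B^* )=\{(x^{**},-x^* )\mid (x^{**},x^* )\in\operatorname{gra}B^*\}$. $\widetilde A^*$ denotes the adjoint of $\widetilde A$. *)

theory Defs
  imports "HOL-Analysis.Analysis"
begin

text \<open>
  For a real normed space \<open>'a\<close> the continuous dual is \<open>'a \<Rightarrow>\<^sub>L real\<close> and the bidual is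
  \<open>('a \<Rightarrow>\<^sub>L real) \<Rightarrow>\<^sub>L real\<close>; the duality pairing of \<open>x\<close> and \<open>xs\<close> is
  \<open>blinfun_apply xs x\<close>. A set-valued operator from \<open>'a\<close> to its dual is a function
  \<open>'a \<Rightarrow> ('a \<Rightarrow>\<^sub>L real) set\<close>.
\<close>

definition gra :: "('a \<Rightarrow> 'b set) \<Rightarrow> ('a \<times> 'b) set"
  where "gra A = {(x, y). y \<in> A x}"

definition monotone_op :: "('a::real_normed_vector \<Rightarrow> ('a \<Rightarrow>\<^sub>L real) set) \<Rightarrow> bool"
  where "monotone_op A \<longleftrightarrow>
    (\<forall>(x, xs) \<in> gra A. \<forall>(y, ys) \<in> gra A. blinfun_apply (xs - ys) (x - y) \<ge> 0)"

definition maximally_monotone_op :: "('a::real_normed_vector \<Rightarrow> ('a \<Rightarrow>\<^sub>L real) set) \<Rightarrow> bool"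
  where "maximally_monotone_op A \<longleftrightarrow>
    monotone_op A \<and> \<not> (\<exists>B. monotone_op B \<and> gra A \<subset> gra B)"

definition enlargement ::
    "real \<Rightarrow> ('a::real_normed_vector \<Rightarrow> ('a \<Rightarrow>\<^sub>L real) set) \<Rightarrow> 'a \<Rightarrow> ('a \<Rightarrow>\<^sub>L real) set"
  where "enlargement \<epsilon> A x =
    {xs. \<forall>(y, ys) \<in> gra A. blinfun_apply (xs - ys) (x - y) \<ge> - \<epsilon>}"

definition non_enlargeable :: "('a::real_normed_vector \<Rightarrow> ('a \<Rightarrow>\<^sub>L real) set) \<Rightarrow> bool"
  where "non_enlargeable A \<longleftrightarrow>
    monotone_op A \<and> (\<forall>\<epsilon>\<ge>0. gra A = gra (enlargement \<epsilon> A))"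

text \<open>The initial topology on \<open>'a\<close> with respect to all continuous linear functionals.\<close>

definition weak_topology :: "'a::real_normed_vector topology"
  where "weak_topology =
    pullback_topology UNIV (\<lambda>x (f :: 'a \<Rightarrow>\<^sub>L real). blinfun_apply f x) euclidean"

text \<open>
  For scalar-valued operators, the strong operator topology is the topology of pointwise
  convergence of functionals, i.e. the weak* topology of the dual.
\<close>

abbreviation weak_star_topology :: "('a::real_normed_vector \<Rightarrow>\<^sub>L real) topology"
  where "weak_star_topology \<equiv> strong_operator_topology"

lift_definition canonical_embedding ::
    "'a::real_normed_vector \<Rightarrow> ('a \<Rightarrow>\<^sub>L real) \<Rightarrow>\<^sub>L real"
  is "\<lambda>x f. blinfun_apply f x"
  by (rule bounded_linear_apply_blinfun)

definition adjoint_op ::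
    "('a::real_normed_vector \<Rightarrow> ('a \<Rightarrow>\<^sub>L real) set)
      \<Rightarrow> (('a \<Rightarrow>\<^sub>L real) \<Rightarrow>\<^sub>L real) \<Rightarrow> ('a \<Rightarrow>\<^sub>L real) set"
  where "adjoint_op B xss =
    {xs. \<forall>(b, bs) \<in> gra B. blinfun_apply xs b = blinfun_apply xss bs}"

text \<open>
  Pointwise negation of the values; the class operation \<open>- T\<close> on set-valued functions
  would be the complement instead.
\<close>

definition neg_op :: "('a \<Rightarrow> 'b::uminus set) \<Rightarrow> 'a \<Rightarrow> 'b set"
  where "neg_op T x = uminus ` T x"

text \<open>
  The trace on \<open>X \<times> X*\<close> of a subset of \<open>X** \<times> X*\<close>, with \<open>X\<close> identified with its canonical image
  in \<open>X**\<close>.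
\<close>

definition trace_on_primal ::
    "((('a::real_normed_vector \<Rightarrow>\<^sub>L real) \<Rightarrow>\<^sub>L real) \<times> ('a \<Rightarrow>\<^sub>L real)) set
      \<Rightarrow> ('a \<times> ('a \<Rightarrow>\<^sub>L real)) set"
  where "trace_on_primal G = {(x, xs). (canonical_embedding x, xs) \<in> G}"

end

theory Submission
  imports Defs
begin

text \<open>
  Write \<open>q (x, x*) = \<langle>x, x*\<rangle>\<close>, let \<open>[\<cdot>, \<cdot>]\<close> be its polar form on \<open>X \<times> X*\<close>, and translate the graph
  to a set \<open>G\<close> containing \<open>0\<close>. Non-enlargeability says that every \<open>z\<close> for which
  \<open>q (z - g) = q z - [z, g] + q g\<close> is bounded below over \<open>g \<in> G\<close> lies in \<open>G\<close>, that is, that the domain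
  of the Fitzpatrick function is \<open>G\<close>. This domain is convex and contains \<open>G\<^sup>\<bottom>\<close>, the trace of the graph
  of minus the adjoint. Conversely, if \<open>G\<close> is convex, then maximality makes it a linear subspace, and
  replacing \<open>g\<close> by \<open>t g\<close> shows that the lower bound forces \<open>[z, g] = 0\<close> whenever \<open>q g = 0\<close>. As \<open>q\<close>
  vanishes on \<open>G\<^sup>\<bottom> \<subseteq> G\<close>, this gives \<open>z \<in> G\<^sup>\<bottom>\<^sup>\<bottom>\<close>, which is \<open>G\<close> because \<open>G\<close> is weak \<open>\<times>\<close> weak* closed.
\<close>

section \<open>The duality pairing as a quadratic form on \<open>X \<times> X*\<close>\<close>

definition duality_form ::
    "'a::real_normed_vector \<times> ('a \<Rightarrow>\<^sub>L real) \<Rightarrow> 'a \<times> ('a \<Rightarrow>\<^sub>L real) \<Rightarrow> real"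
  where "duality_form p r = blinfun_apply (snd r) (fst p) + blinfun_apply (snd p) (fst r)"

definition duality_quad :: "'a::real_normed_vector \<times> ('a \<Rightarrow>\<^sub>L real) \<Rightarrow> real"
  where "duality_quad p = blinfun_apply (snd p) (fst p)"

lemma bilinear_duality_form: "bilinear duality_form"
  unfolding bilinear_def duality_form_def
  by (auto intro!: linearI simp: blinfun.bilinear_simps algebra_simps)

lemmas duality_form_simps =
  bilinear_ladd[OF bilinear_duality_form] bilinear_radd[OF bilinear_duality_form]
  bilinear_lmul[OF bilinear_duality_form] bilinear_rmul[OF bilinear_duality_form]
  bilinear_lsub[OF bilinear_duality_form] bilinear_rsub[OF bilinear_duality_form]

lemma duality_form_commute: "duality_form p r = duality_form r p"
  by (simp add: duality_form_def)

lemma duality_form_self: "duality_form p p = 2 * duality_quad p"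
  by (simp add: duality_form_def duality_quad_def)

lemma duality_quad_diff: "duality_quad (p - r) = duality_quad p - duality_form p r + duality_quad r"
  by (simp add: duality_form_def duality_quad_def blinfun.bilinear_simps algebra_simps)

lemma duality_quad_scaleR: "duality_quad (t *\<^sub>R p) = t\<^sup>2 * duality_quad p"
  by (simp add: duality_quad_def blinfun.bilinear_simps power2_eq_square)

lemma duality_quad_zero [simp]: "duality_quad 0 = 0"
  by (simp add: duality_quad_def)

section \<open>Monotonicity, enlargements and adjoints in terms of the quadratic form\<close>

definition monotone_set :: "('a::real_normed_vector \<times> ('a \<Rightarrow>\<^sub>L real)) set \<Rightarrow> bool"
  where "monotone_set S \<longleftrightarrow> (\<forall>p\<in>S. \<forall>r\<in>S. duality_quad (p - r) \<ge> 0)"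

lemma monotone_op_iff: "monotone_op A \<longleftrightarrow> monotone_set (gra A)"
  by (auto simp: monotone_op_def monotone_set_def duality_quad_def split_beta)

text \<open>Every set of pairs is the graph of some operator, so maximality can be tested against
  arbitrary monotone sets.\<close>

lemma maximally_monotone_opD:
  assumes "maximally_monotone_op A" "monotone_set S" "gra A \<subseteq> S"
  shows "S = gra A"
proof -
  have "gra (\<lambda>x. {y. (x, y) \<in> S}) = S"
    by (auto simp: gra_def)
  then show ?thesis
    using assms unfolding maximally_monotone_op_def monotone_op_iff by (metis psubsetI)
qed

text \<open>Since \<epsilon> ranges over all nonnegative reals, only the existence of a lower bound
  matters. A bound \<open>c\<close> of either sign is weakened to
  \<open>- \<bar>c\<bar>\<close>.\<close>

lemma non_enlargeable_iff:
  assumes "monotone_op A"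
  shows "non_enlargeable A \<longleftrightarrow>
    (\<forall>p c. (\<forall>r\<in>gra A. duality_quad (p - r) \<ge> c) \<longrightarrow> p \<in> gra A)" (is "_ = ?R")
proof -
  have enl: "p \<in> gra (enlargement \<epsilon> A) \<longleftrightarrow> (\<forall>r\<in>gra A. duality_quad (p - r) \<ge> - \<epsilon>)" for p \<epsilon>
    by (auto simp: gra_def enlargement_def duality_quad_def split_beta)
  show ?thesis
  proof
    assume L: "non_enlargeable A"
    show ?R
    proof (intro allI impI)
      fix p c assume c: "\<forall>r\<in>gra A. duality_quad (p - r) \<ge> c"
      then have "p \<in> gra (enlargement \<bar>c\<bar> A)"
        unfolding enl by force
      then show "p \<in> gra A"
        using L unfolding non_enlargeable_def by (metis abs_ge_zero)
    qed
  next
    assume R: ?R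
    have "gra A = gra (enlargement \<epsilon> A)" if "\<epsilon> \<ge> 0" for \<epsilon>
    proof (intro set_eqI iffI)
      fix p assume "p \<in> gra A"
      then show "p \<in> gra (enlargement \<epsilon> A)"
        using assms that unfolding enl monotone_op_iff monotone_set_def by force
    qed (use R enl in blast)
    then show "non_enlargeable A"
      using assms by (simp add: non_enlargeable_def)
  qed
qed

text \<open>The minus sign moves both pairings of the adjoint equation to one side, where they add
  up to the symmetric form. The trace is thus the orthogonal complement of the graph.\<close>

lemma trace_neg_adjoint_iff:
  "z \<in> trace_on_primal (gra (neg_op (adjoint_op B))) \<longleftrightarrow> (\<forall>g\<in>gra B. duality_form z g = 0)"
proof -
  obtain x xs where z: "z = (x, xs)" by fastforce
  have "z \<in> trace_on_primal (gra (neg_op (adjoint_op B))) \<longleftrightarrow>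
      - xs \<in> adjoint_op B (canonical_embedding x)"
    by (force simp: z trace_on_primal_def gra_def neg_op_def)
  also have "\<dots> \<longleftrightarrow> (\<forall>g\<in>gra B. duality_form z g = 0)"
    by (auto simp: z adjoint_op_def canonical_embedding.rep_eq duality_form_def
        blinfun.bilinear_simps split_beta)
  finally show ?thesis .
qed

lemma trace_adjoint_iff:
  "(x, xs) \<in> trace_on_primal (gra (adjoint_op B)) \<longleftrightarrow>
    (x, - xs) \<in> trace_on_primal (gra (neg_op (adjoint_op B)))"
  by (auto simp: trace_on_primal_def gra_def neg_op_def)

section \<open>Linearity of convex maximally monotone sets\<close>

text \<open>Maximality absorbs larger monotone sets: first the cone generated by \<open>G\<close>,
  which with convexity gives sums, then the set of differences.\<close>

lemma monotone_subspace_if_maximal_convex: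
  fixes G :: "('a::real_normed_vector \<times> ('a \<Rightarrow>\<^sub>L real)) set"
  assumes mono: "monotone_set G"
    and max: "\<And>S. monotone_set S \<Longrightarrow> G \<subseteq> S \<Longrightarrow> S = G"
    and conv: "convex G" and zero: "0 \<in> G"
  shows "subspace G"
proof -
  have shrink: "c *\<^sub>R g \<in> G" if "g \<in> G" "0 \<le> c" "c \<le> 1" for c g
    using convexD[OF conv that(1) zero, of c "1 - c"] that by simp
  have "monotone_set {t *\<^sub>R g | t g. 0 \<le> t \<and> g \<in> G}"
    unfolding monotone_set_def
  proof (intro ballI)
    fix p p' assume "p \<in> {t *\<^sub>R g | t g. 0 \<le> t \<and> g \<in> G}" "p' \<in> {t *\<^sub>R g | t g. 0 \<le> t \<and> g \<in> G}"
    then obtain t s g h where p: "p = t *\<^sub>R g" "p' = s *\<^sub>R h"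
      and ts: "0 \<le> t" "0 \<le> s" and gh: "g \<in> G" "h \<in> G"
      by blast
    \<comment> \<open>A common scale: \<open>t / r\<close> and \<open>s / r\<close> are at most 1,
      so both points shrink into \<open>G\<close>, and the form only changes by the factor
      \<open>r\<^sup>2\<close>. The summand 1 keeps \<open>r\<close> positive when
      \<open>t = s = 0\<close>.\<close>
    define r where "r = t + s + 1"
    have r: "r > 0" using ts by (simp add: r_def)
    have "(t / r) *\<^sub>R g \<in> G" "(s / r) *\<^sub>R h \<in> G"
      using ts gh r by (auto intro!: shrink simp: r_def)
    then have "0 \<le> r\<^sup>2 * duality_quad ((t / r) *\<^sub>R g - (s / r) *\<^sub>R h)"
      using mono by (simp add: monotone_set_def)
    also have "\<dots> = duality_quad (t *\<^sub>R g - s *\<^sub>R h)"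
      using r by (simp flip: duality_quad_scaleR add: scaleR_diff_right)
    finally show "duality_quad (p - p') \<ge> 0"
      by (simp add: p)
  qed
  moreover have "G \<subseteq> {t *\<^sub>R g | t g. 0 \<le> t \<and> g \<in> G}"
    by clarify (rule exI[of _ 1], auto)
  ultimately have "{t *\<^sub>R g | t g. 0 \<le> t \<and> g \<in> G} = G"
    by (rule max)
  then have cone: "t *\<^sub>R g \<in> G" if "0 \<le> t" "g \<in> G" for t g
    using that by blast
  have add: "g + h \<in> G" if "g \<in> G" "h \<in> G" for g h
    using cone[OF _ convexD[OF conv that, of "1/2" "1/2"], of 2] by (simp add: scaleR_add_right)
  have "monotone_set {g - h | g h. g \<in> G \<and> h \<in> G}"
    unfolding monotone_set_def
  proof (intro ballI)
    fix p p' assume "p \<in> {g - h | g h. g \<in> G \<and> h \<in> G}" "p' \<in> {g - h | g h. g \<in> G \<and> h \<in> G}"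
    then obtain g h g' h' where p: "p = g - h" "p' = g' - h'"
      and "g \<in> G" "h \<in> G" "g' \<in> G" "h' \<in> G"
      by blast
    \<comment> \<open>Regrouping writes a difference of differences as a difference of two sums,
      both in \<open>G\<close>.\<close>
    then have "duality_quad ((g + h') - (h + g')) \<ge> 0"
      using mono add by (simp add: monotone_set_def)
    then show "duality_quad (p - p') \<ge> 0"
      by (simp add: p algebra_simps)
  qed
  moreover have "G \<subseteq> {g - h | g h. g \<in> G \<and> h \<in> G}"
    using zero by clarify (metis diff_zero)
  ultimately have "{g - h | g h. g \<in> G \<and> h \<in> G} = G"
    by (rule max)
  then have diff: "g - h \<in> G" if "g \<in> G" "h \<in> G" for g h
    using that by blast
  show ?thesis
  proof (rule subspaceI)
    fix c g assume "g \<in> G"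
    then show "c *\<^sub>R g \<in> G"
      using cone[of c g] diff[OF zero cone[of "-c" g]] by (cases "c \<ge> 0") auto
  qed (use zero add in auto)
qed

section \<open>Double orthogonal complements and the weak \<times> weak* topology\<close>

text \<open>Gaussian elimination, one functional at a time: if \<open>B f\<close> is nonzero on
  \<open>G\<close> it serves as pivot, and the remaining equations are solved on its kernel in
  \<open>G\<close>. This replaces Hahn-Banach separation in the proof of
  \<open>G\<^sup>\<bottom>\<^sup>\<bottom> = G\<close>.\<close>

lemma finite_bilinear_interpolation:
  assumes B: "bilinear (B :: 'w::real_vector \<Rightarrow> 'v::real_vector \<Rightarrow> real)"
    and "finite F" "subspace G"
    and "\<And>w. w \<in> span F \<Longrightarrow> (\<And>g. g \<in> G \<Longrightarrow> B w g = 0) \<Longrightarrow> B w z = 0"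
  shows "\<exists>g\<in>G. \<forall>w\<in>F. B w g = B w z"
  using assms(2-)
proof (induction F arbitrary: G z rule: finite_induct)
  case empty
  then show ?case by (auto intro: subspace_0)
next
  case (insert f F)
  note B_simps = bilinear_ladd[OF B] bilinear_radd[OF B] bilinear_lmul[OF B] bilinear_rmul[OF B]
    bilinear_lsub[OF B] bilinear_rsub[OF B]
  have span_mono': "w \<in> span (insert f F)" if "w \<in> span F" for w
    using that span_mono[of F "insert f F"] by auto
  show ?case
  proof (cases "\<forall>g\<in>G. B f g = 0")
    case True
    then have "B f z = 0"
      by (auto intro: insert.prems(2) span_base)
    moreover obtain g where "g \<in> G" "\<forall>w\<in>F. B w g = B w z"
      using insert.IH[OF insert.prems(1)] insert.prems(2) span_mono' by blast
    ultimately show ?thesis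
      using True by (intro bexI[of _ g]) auto
  next
    case False
    then obtain g1 where g1: "g1 \<in> G" "B f g1 \<noteq> 0" by auto
    define g0 where "g0 = (1 / B f g1) *\<^sub>R g1"
    have g0: "g0 \<in> G" "B f g0 = 1"
      using g1 insert.prems(1) by (auto simp: g0_def B_simps subspace_scale)
    define G' where "G' = {g \<in> G. B f g = 0}"
    have sub: "subspace G'"
      using insert.prems(1) bilinear_rzero[OF B]
      by (auto simp: G'_def subspace_def B_simps)
    have "\<exists>g\<in>G'. \<forall>w\<in>F. B w g = B w (z - B f z *\<^sub>R g0)"
    proof (rule insert.IH[OF sub])
      fix w assume w: "w \<in> span F" "\<And>g. g \<in> G' \<Longrightarrow> B w g = 0"
      \<comment> \<open>The elimination is shifted from \<open>g\<close> to \<open>w\<close>: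
        applying \<open>B (w - B w g0 *\<^sub>R f)\<close> to \<open>g\<close> is applying
        \<open>B w\<close> to the projection \<open>g - B f g *\<^sub>R g0\<close>, which lies in
        \<open>G'\<close>.\<close>
      have "B (w - B w g0 *\<^sub>R f) z = 0"
      proof (rule insert.prems(2))
        show "w - B w g0 *\<^sub>R f \<in> span (insert f F)"
          by (intro span_diff span_scale span_mono' w span_base) simp
        fix g assume "g \<in> G"
        then have "g - B f g *\<^sub>R g0 \<in> G'"
          using g0 insert.prems(1) by (auto simp: G'_def B_simps subspace_diff subspace_scale)
        from w(2)[OF this] show "B (w - B w g0 *\<^sub>R f) g = 0"
          by (simp add: B_simps)
      qed
      then show "B w (z - B f z *\<^sub>R g0) = 0"
        by (simp add: B_simps)
    qed
    then obtain g where "g \<in> G'" "\<forall>w\<in>F. B w g = B w (z - B f z *\<^sub>R g0)" by blast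
    then show ?thesis
      using g0 insert.prems(1)
      by (intro bexI[of _ "g + B f z *\<^sub>R g0"]) (auto simp: G'_def B_simps subspace_add subspace_scale)
  qed
qed

text \<open>A basic product box around \<open>x\<close> constrains only finitely many
  coordinates.\<close>

lemma open_fun_finite_dependence:
  fixes T :: "('i \<Rightarrow> 'b::topological_space) set"
  assumes "open T" "x \<in> T"
  obtains I where "finite I" "\<And>y. (\<And>i. i \<in> I \<Longrightarrow> y i = x i) \<Longrightarrow> y \<in> T"
proof -
  from assms have "openin (product_topology (\<lambda>i. euclidean) UNIV) T"
    by (simp add: open_fun_def)
  from product_topology_open_contains_basis[OF this \<open>x \<in> T\<close>]
  obtain X where X: "x \<in> Pi\<^sub>E UNIV X" "finite {i. X i \<noteq> UNIV}" "Pi\<^sub>E UNIV X \<subseteq> T"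
    by auto
  show ?thesis
  proof (rule that[OF X(2)])
    fix y assume y: "\<And>i. i \<in> {i. X i \<noteq> UNIV} \<Longrightarrow> y i = x i"
    have "y i \<in> X i" for i
      using X(1) y[of i] by (cases "X i = UNIV") (auto simp: PiE_iff)
    then show "y \<in> T"
      using X(3) by (auto simp: PiE_iff)
  qed
qed

text \<open>Both topologies are pulled back from pointwise convergence, so a neighbourhood of
  \<open>p\<close> missing \<open>G\<close> contains all points that agree with \<open>p\<close>
  under finitely many evaluations.\<close>

lemma weak_weak_star_closed_separation:
  assumes "closedin (prod_topology weak_topology weak_star_topology) G" "p \<notin> G"
  obtains F where "finite F" "\<And>r. (\<And>w. w \<in> F \<Longrightarrow> duality_form w r = duality_form w p) \<Longrightarrow> r \<notin> G"
proof -
  obtain x xs where p: "p = (x, xs)" by fastforce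
  have top: "topspace (prod_topology weak_topology weak_star_topology) = UNIV"
    by (simp add: weak_topology_def topspace_pullback_topology strong_operator_topology_topspace)
  then have "openin (prod_topology weak_topology weak_star_topology) (- G)"
    using assms(1) unfolding closedin_def top Compl_eq_Diff_UNIV by blast
  then obtain U V where U: "openin weak_topology U" "x \<in> U" and V: "openin weak_star_topology V"
      "xs \<in> V" and UV: "U \<times> V \<subseteq> - G"
    using assms(2) unfolding openin_prod_topology_alt p by (metis ComplI)
  obtain T where T: "open T" "U = (\<lambda>x (f :: 'a \<Rightarrow>\<^sub>L real). blinfun_apply f x) -` T"
    using U(1) by (auto simp: weak_topology_def openin_pullback_topology)
  obtain T' where T': "open T'" "V = blinfun_apply -` T'"
    using V(1) by (auto simp: strong_operator_topology_def openin_pullback_topology)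
  obtain I where I: "finite I" "\<And>y. (\<And>f. f \<in> I \<Longrightarrow> y f = blinfun_apply f x) \<Longrightarrow> y \<in> T"
    using open_fun_finite_dependence[OF T(1)] U(2) T(2) by (metis vimageE)
  obtain J where J: "finite J" "\<And>y. (\<And>b. b \<in> J \<Longrightarrow> y b = blinfun_apply xs b) \<Longrightarrow> y \<in> T'"
    using open_fun_finite_dependence[OF T'(1)] V(2) T'(2) by (metis vimageE)
  show ?thesis
  proof (rule that)
    \<comment> \<open>Pairing with \<open>(0, f)\<close> evaluates \<open>f\<close> at the first
      component; pairing with \<open>(b, 0)\<close> evaluates the second component at
      \<open>b\<close>.\<close>
    show "finite (Pair 0 ` I \<union> (\<lambda>b. (b, 0)) ` J)"
      using I J by simp
    fix r assume r: "\<And>w. w \<in> Pair 0 ` I \<union> (\<lambda>b. (b, 0)) ` J \<Longrightarrow>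
        duality_form w r = duality_form w p"
    have "fst r \<in> U"
      unfolding T(2) vimage_def
      using r[of "(0, _)"] by (auto intro!: I(2) simp: duality_form_def p)
    moreover have "snd r \<in> V"
      unfolding T'(2) vimage_def
      using r[of "(_, 0)"] by (auto intro!: J(2) simp: duality_form_def p)
    ultimately show "r \<notin> G"
      using UV by (metis ComplD mem_Times_iff subsetD)
  qed
qed

section \<open>The equivalence for the translated graph\<close>

lemma bounded_multiples_imp_zero:
  fixes b c :: real
  assumes "\<And>t. t * b \<le> c"
  shows "b = 0"
proof (rule ccontr)
  assume "b \<noteq> 0"
  then show False using assms[of "(c + 1) / b"] by simp
qed

theorem corollary4p2:
  fixes A At :: "'a::banach \<Rightarrow> ('a \<Rightarrow>\<^sub>L real) set"
    and a :: 'a and as :: "'a \<Rightarrow>\<^sub>L real"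
  assumes "maximally_monotone_op A"
    and "closedin (prod_topology weak_topology weak_star_topology) (gra A)"
    and "(a, as) \<in> gra A"
    and "gra At = (\<lambda>p. p - (a, as)) ` gra A"
  shows "(non_enlargeable A \<longleftrightarrow>
            convex (gra A) \<and> trace_on_primal (gra (neg_op (adjoint_op At))) \<subseteq> gra At)
       \<and> (non_enlargeable A \<longrightarrow>
            (\<forall>(x, xs) \<in> trace_on_primal (gra (adjoint_op At)). blinfun_apply xs x = 0))"
proof -
  define G where "G = gra At"
  define P where "P = trace_on_primal (gra (neg_op (adjoint_op At)))"
  define d where "d = (a, as)"
  have P_iff: "z \<in> P \<longleftrightarrow> (\<forall>g\<in>G. duality_form z g = 0)" for z
    by (simp add: P_def G_def trace_neg_adjoint_iff)
  have G_eq: "G = (\<lambda>p. p - d) ` gra A"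
    using assms(4) by (simp add: G_def d_def)
  have G_iff: "z \<in> G \<longleftrightarrow> z + d \<in> gra A" for z
    by (force simp: G_eq image_iff)
  have zero: "0 \<in> G"
    using assms(3) by (simp add: G_iff d_def)
  have mono_op: "monotone_op A"
    using assms(1) by (simp add: maximally_monotone_op_def)
  then have mono: "monotone_set G"
    by (auto simp: monotone_op_iff monotone_set_def G_eq)
  have nonneg: "duality_quad g \<ge> 0" if "g \<in> G" for g
    using mono that zero by (force simp: monotone_set_def)
  have max: "S = G" if S: "monotone_set S" "G \<subseteq> S" for S
  proof -
    have "(\<lambda>p. p + d) ` S = gra A"
    proof (rule maximally_monotone_opD[OF assms(1)])
      show "monotone_set ((\<lambda>p. p + d) ` S)"
        using S(1) by (auto simp: monotone_set_def)
      show "gra A \<subseteq> (\<lambda>p. p + d) ` S"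
        using S(2) by (force simp: G_eq image_iff)
    qed
    then show ?thesis
      by (force simp: G_eq image_image)
  qed
  have "(\<forall>p c. (\<forall>r\<in>gra A. duality_quad (p - r) \<ge> c) \<longrightarrow> p \<in> gra A) \<longleftrightarrow>
      (\<forall>z c. (\<forall>g\<in>G. duality_quad (z - g) \<ge> c) \<longrightarrow> z \<in> G)" (is "?L = ?R")
  proof
    assume L: ?L
    show ?R
    proof (intro allI impI)
      fix z c assume "\<forall>g\<in>G. duality_quad (z - g) \<ge> c"
      then have "\<forall>r\<in>gra A. duality_quad (z + d - r) \<ge> c"
        by (simp add: G_eq algebra_simps)
      then show "z \<in> G"
        using L G_iff by blast
    qed
  next
    assume R: ?R
    show ?L
    proof (intro allI impI)
      fix p c assume "\<forall>r\<in>gra A. duality_quad (p - r) \<ge> c"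
      then have "\<forall>g\<in>G. duality_quad (p - d - g) \<ge> c"
        by (auto simp: G_eq)
      then have "p - d \<in> G" using R by blast
      then show "p \<in> gra A" by (simp add: G_iff)
    qed
  qed
  then have ne_iff: "non_enlargeable A \<longleftrightarrow> ?R"
    using non_enlargeable_iff[OF mono_op] by simp
  have P_sub: "P \<subseteq> G" if "?R"
  proof
    fix z assume z: "z \<in> P"
    \<comment> \<open>The mixed term vanishes by orthogonality, and the form is nonnegative on
      \<open>G\<close> because \<open>0 \<in> G\<close>.\<close>
    have "\<forall>g\<in>G. duality_quad (z - g) \<ge> duality_quad z"
      using z nonneg by (simp add: P_iff duality_quad_diff)
    then show "z \<in> G" using that by blast
  qed
  \<comment> \<open>As a member of both \<open>P\<close> and \<open>G\<close>, \<open>z\<close> is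
    orthogonal to itself.\<close>
  have isotropic: "duality_quad z = 0" if "P \<subseteq> G" "z \<in> P" for z
    using that P_iff[of z] duality_form_self[of z] by auto
  have conv_iff: "convex (gra A) \<longleftrightarrow> convex G"
    using convex_translation_subtract_eq[of d "gra A"] by (simp add: G_eq)
  have conv: "convex G" if "?R"
  proof (rule convexI)
    fix p p' :: "'a \<times> ('a \<Rightarrow>\<^sub>L real)" and u v :: real
    assume pp: "p \<in> G" "p' \<in> G" and uv: "0 \<le> u" "0 \<le> v" "u + v = 1"
    define z where "z = u *\<^sub>R p + v *\<^sub>R p'"
    \<comment> \<open>Averaging the monotonicity inequalities for \<open>p\<close> and
      \<open>p'\<close> merges their mixed terms into that of \<open>z\<close>. The remaining
      constant is independent of \<open>g\<close>.\<close>
    have "duality_quad (z - g) \<ge> duality_quad z - u * duality_quad p - v * duality_quad p'"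
      if "g \<in> G" for g
    proof -
      have "0 \<le> u * duality_quad (p - g) + v * duality_quad (p' - g)"
        using mono pp that uv by (simp add: monotone_set_def)
      moreover have "u * duality_quad g + v * duality_quad g = duality_quad g"
        using uv by (simp flip: distrib_right)
      ultimately show ?thesis
        by (simp add: duality_quad_diff z_def[symmetric] algebra_simps)
          (simp add: z_def duality_form_simps algebra_simps)
    qed
    then show "u *\<^sub>R p + v *\<^sub>R p' \<in> G"
      using that unfolding z_def by blast
  qed
  have ne_if_convex: "?R" if "convex G" "P \<subseteq> G"
  proof (intro allI impI)
    fix z c assume c: "\<forall>g\<in>G. duality_quad (z - g) \<ge> c"
    have sub: "subspace G"
      by (rule monotone_subspace_if_maximal_convex[OF mono max that(1) zero])
    have perp: "duality_form w z = 0" if w: "w \<in> P" for w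
    proof -
      \<comment> \<open>Along the line through \<open>w\<close> the quadratic term vanishes, so the
        lower bound is affine in \<open>t\<close>; it holds for every real \<open>t\<close>.\<close>
      have "t * duality_form z w \<le> duality_quad z - c" for t
      proof -
        have "t *\<^sub>R w \<in> G"
          using w \<open>P \<subseteq> G\<close> sub by (auto intro: subspace_scale)
        then have "duality_quad (z - t *\<^sub>R w) \<ge> c"
          using c by blast
        then show ?thesis
          by (simp add: duality_quad_diff duality_quad_scaleR duality_form_simps
              isotropic[OF \<open>P \<subseteq> G\<close> w])
      qed
      then have "duality_form z w = 0"
        by (rule bounded_multiples_imp_zero)
      then show ?thesis
        by (simp add: duality_form_commute)
    qed
    show "z \<in> G"
    proof (rule ccontr)
      assume "z \<notin> G"
      then have "z + d \<notin> gra A" by (simp add: G_iff)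
      then obtain F where F: "finite F"
        "\<And>r. (\<And>w. w \<in> F \<Longrightarrow> duality_form w r = duality_form w (z + d)) \<Longrightarrow> r \<notin> gra A"
        using weak_weak_star_closed_separation[OF assms(2)] by metis
      \<comment> \<open>An element of \<open>span F\<close> orthogonal to \<open>G\<close> lies in
        \<open>P\<close>, hence is orthogonal to \<open>z\<close> by \<open>perp\<close>. The
        resulting \<open>g + d\<close> is in \<open>gra A\<close> but indistinguishable from
        \<open>z + d\<close> by \<open>F\<close>.\<close>
      have "\<exists>g\<in>G. \<forall>w\<in>F. duality_form w g = duality_form w z"
        by (rule finite_bilinear_interpolation[OF bilinear_duality_form F(1) sub])
          (auto intro!: perp simp: P_iff)
      then obtain g where "g \<in> G" "\<forall>w\<in>F. duality_form w g = duality_form w z" by blast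
      then show False
        using F(2)[of "g + d"] by (auto simp: G_iff duality_form_simps)
    qed
  qed
  \<comment> \<open>Here \<open>(x, - xs)\<close> lies in \<open>P\<close>, so it is isotropic; the
    sign does not affect vanishing.\<close>
  have "blinfun_apply xs x = 0"
    if "?R" "(x, xs) \<in> trace_on_primal (gra (adjoint_op At))" for x xs
    using isotropic[OF P_sub[OF that(1)], of "(x, - xs)"] that(2)
    by (simp add: trace_adjoint_iff P_def duality_quad_def blinfun.bilinear_simps)
  then show ?thesis
    unfolding ne_iff conv_iff using conv P_sub ne_if_convex by (auto simp: P_def G_def)
qed

end
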